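(* The set of functions $h\in\mathrm{PCC}(\Omega)$ with $S_h(\alpha_{h,\max}^* )>0$ is dense in $C(\Omega)$.
   Context: $\Omega=\{0,1\}^{\mathbb N}$ ($\mathbb N=\{1,2,\dots\}$) with the metric $d(\omega,\omega')=\sum_{k\ge1}|\omega_k-\omega'_k|2^{-k}$; $\sigma:\Omega\to\Omega$ is the one-sided shift, $(\sigma\omega)_k=\omega_{k+1}$. $C(\Omega)$ is the space of continuous functions $\Omega\to\mathbb R$ with the supremum norm. $\mathrm{PCC}^k(\Omega)$ is the set of functions $f\in C(\Omega)$ such that $f(\omega)$ depends only on the first $k$ coordinates $\omega_1,\dots,\omega_k$, and $\mathrm{PCC}(\Omega)=\bigcup_{k}\mathrm{PCC}^k(\Omega)$. For $f\in C(\Omega)$ and $\alpha\in\mathbb R$, $E_f(\alpha)=\{\omega\in\Omega:\lim_{N\to\infty}\frac1N\sum_{n=1}^N f(\sigma^n\omega)=\alpha\}$, $S_f(\alpha)=\dim_H E_f(\alpha)$ (Hausdorff dimension with respect to $d$; $\dim_H\emptyset=0$), and $\alpha_{f,\max}^*=\sup\{\alpha\in\mathbb R:E_f(\alpha)\ne\emptyset\}$. *)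

theory Defs
  imports "HOL-Analysis.Analysis"
begin

section \<open>The one-sided full shift on two symbols\<close>

text \<open>
  Coordinates are indexed from 0: the coordinate \<open>\<omega>\<^sub>k\<close> (\<open>k \<ge> 1\<close>) is \<open>coord \<omega> (k - 1)\<close>, so
  that its weight in the metric is \<open>2\<^sup>-\<^sup>k = (1/2)^Suc (k - 1)\<close>. The symbols 0 and 1 are
  \<open>False\<close> and \<open>True\<close>. A type of its own is needed because \<^typ>\<open>nat \<Rightarrow> bool\<close> already carries
  a topology through the type class system.
\<close>

typedef bitseq = "UNIV :: (nat \<Rightarrow> bool) set"
  morphisms coord bitseq ..

lemma coord_bitseq [simp]: "coord (bitseq x) = x"
  by (simp add: bitseq_inverse)

lemma summable_bitseq_dist:
  "summable (\<lambda>k. \<bar>of_bool (x k) - of_bool (y k)\<bar> * (1/2::real) ^ Suc k)"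
proof (rule summable_comparison_test')
  show "summable (\<lambda>k. (1/2::real) ^ Suc k)"
    by (intro summable_Suc_iff[THEN iffD2] summable_geometric) simp
qed (auto simp: of_bool_def)

instantiation bitseq :: metric_space
begin

definition dist_bitseq :: "bitseq \<Rightarrow> bitseq \<Rightarrow> real" where
  "dist \<omega> \<omega>' = (\<Sum>k. \<bar>of_bool (coord \<omega> k) - of_bool (coord \<omega>' k)\<bar> * (1/2) ^ Suc k)"

definition uniformity_bitseq :: "(bitseq \<times> bitseq) filter" where
  "uniformity_bitseq = (INF e\<in>{0 <..}. principal {(x, y). dist x y < e})"

definition open_bitseq :: "bitseq set \<Rightarrow> bool" where
  "open_bitseq U \<longleftrightarrow> (\<forall>x\<in>U. \<forall>\<^sub>F (x', y) in uniformity. x' = x \<longrightarrow> y \<in> U)"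

instance
proof
  fix x y z :: bitseq
  show "dist x y = 0 \<longleftrightarrow> x = y"
  proof -
    have "dist x y = 0 \<longleftrightarrow>
        (\<forall>k. \<bar>of_bool (coord x k) - of_bool (coord y k)\<bar> * (1/2::real) ^ Suc k = 0)"
      unfolding dist_bitseq_def by (rule suminf_eq_zero_iff[OF summable_bitseq_dist]) auto
    also have "\<dots> \<longleftrightarrow> coord x = coord y"
      by (auto simp: of_bool_def fun_eq_iff split: if_splits)
    finally show ?thesis
      by (simp add: coord_inject)
  qed
  show "dist x y \<le> dist x z + dist y z"
    unfolding dist_bitseq_def
    apply (subst suminf_add[OF summable_bitseq_dist summable_bitseq_dist])
    apply (rule suminf_le[OF _ summable_bitseq_dist summable_add[OF summable_bitseq_dist summable_bitseq_dist]])
    apply (auto simp: of_bool_def)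
    done
qed (fact uniformity_bitseq_def open_bitseq_def)+

end

lemma dist_bitseq_le:
  assumes "\<And>i. i < n \<Longrightarrow> coord \<omega> i = coord \<omega>' i"
  shows "dist \<omega> \<omega>' \<le> (1/2) ^ n"
proof -
  let ?f = "\<lambda>k. \<bar>of_bool (coord \<omega> k) - of_bool (coord \<omega>' k)\<bar> * (1/2::real) ^ Suc k"
  have s: "summable (\<lambda>k. (1/2::real) ^ (k + Suc n))"
    by (simp add: power_add summable_mult2)
  have "dist \<omega> \<omega>' = (\<Sum>k. ?f (k + n)) + (\<Sum>k<n. ?f k)"
    unfolding dist_bitseq_def by (rule suminf_split_initial_segment[OF summable_bitseq_dist])
  also have "(\<Sum>k<n. ?f k) = 0"
    using assms by simp
  also have "(\<Sum>k. ?f (k + n)) \<le> (\<Sum>k. (1/2::real) ^ (k + Suc n))"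
    by (rule suminf_le[OF _ summable_ignore_initial_segment[OF summable_bitseq_dist] s])
       (auto simp: of_bool_def)
  also have "\<dots> = (\<Sum>k. (1/2::real) ^ k * (1/2) ^ Suc n)"
    by (simp add: power_add)
  also have "\<dots> = (1/2) ^ n"
    by (subst suminf_mult2[symmetric]) (auto simp: suminf_geometric)
  finally show ?thesis by simp
qed

lemma continuous_on_bitseq: "continuous_on UNIV bitseq"
  unfolding continuous_on_topological
proof (intro ballI allI impI)
  fix x :: "nat \<Rightarrow> bool" and B
  assume "open B" "bitseq x \<in> B"
  then obtain e where e: "e > 0" "ball (bitseq x) e \<subseteq> B"
    using open_contains_ball by blast
  obtain n where n: "(1/2::real) ^ n < e"
    using real_arch_pow_inv[OF e(1), of "1/2"] by auto
  define A where "A = (\<Pi>\<^sub>E i\<in>UNIV. if i < n then {x i} else UNIV)"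
  have "open A"
    unfolding A_def
  proof (rule open_PiE)
    show "finite {i. (if i < n then {x i} else UNIV) \<noteq> UNIV}"
      by (rule finite_subset[of _ "{..<n}"]) auto
  qed (auto simp: open_discrete)
  moreover have "x \<in> A"
    by (auto simp: A_def)
  moreover have "bitseq y \<in> B" if "y \<in> A" for y
  proof -
    have "y i = x i" if "i < n" for i
    proof -
      have "y i \<in> (if i < n then {x i} else UNIV)"
        using \<open>y \<in> A\<close> unfolding A_def by (rule PiE_mem) simp
      with that show ?thesis by simp
    qed
    then have "dist (bitseq x) (bitseq y) \<le> (1/2) ^ n"
      by (intro dist_bitseq_le) auto
    with n e show ?thesis by auto
  qed
  ultimately show "\<exists>A. open A \<and> x \<in> A \<and> (\<forall>y\<in>UNIV. y \<in> A \<longrightarrow> bitseq y \<in> B)"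
    by blast
qed

lemma compact_UNIV_bitseq: "compact (UNIV :: bitseq set)"
proof -
  have "compact_space (product_topology (\<lambda>_::nat. euclidean :: bool topology) UNIV)"
    by (subst compact_space_product_topology) (auto simp: compact_space_def finite_imp_compact)
  then have "compact (UNIV :: (nat \<Rightarrow> bool) set)"
    by (simp add: compact_space_def euclidean_product_topology)
  then have "compact (range bitseq)"
    by (rule compact_continuous_image[OF continuous_on_bitseq])
  also have "range bitseq = UNIV"
    by (metis surj_def coord_inverse)
  finally show ?thesis .
qed

definition shift :: "bitseq \<Rightarrow> bitseq" where
  "shift \<omega> = bitseq (\<lambda>k. coord \<omega> (Suc k))"


section \<open>Continuous functions on the shift space\<close>

text \<open>
  Since the shift space is compact, every continuous real function on it is bounded. So
  \<open>C(\<Omega>)\<close> with the supremum norm is the library type of bounded continuous functions.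
\<close>

type_synonym cfun = "bitseq \<Rightarrow>\<^sub>C real"

lemma continuous_on_imp_bcontfun:
  fixes f :: "bitseq \<Rightarrow> real"
  assumes "continuous_on UNIV f"
  shows "f \<in> bcontfun"
  using assms compact_continuous_image[OF assms compact_UNIV_bitseq]
  by (simp add: bcontfun_def compact_imp_bounded)

definition PCC_at :: "nat \<Rightarrow> cfun set" where
  "PCC_at k = {f :: cfun. \<forall>\<omega> \<omega>'. (\<forall>i<k. coord \<omega> i = coord \<omega>' i) \<longrightarrow> f \<omega> = f \<omega>'}"

definition PCC :: "cfun set" where
  "PCC = (\<Union>k\<in>{1..}. PCC_at k)"


section \<open>Hausdorff dimension\<close>

text \<open>
  \<open>(diam U)\<^sup>s\<close>, with the conventions \<open>(diam {})\<^sup>s = 0\<close> and \<open>(diam U)\<^sup>0 = 1\<close> for nonempty \<open>U\<close>.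
  The second one has to be spelled out because \<open>0 powr 0 = 0\<close>.
\<close>

definition diam_pow :: "real \<Rightarrow> 'a::metric_space set \<Rightarrow> real" where
  "diam_pow s U = (if U = {} then 0 else if s = 0 then 1 else diameter U powr s)"

text \<open>
  Boundedness of the covering sets is required explicitly because \<^const>\<open>diameter\<close> has no
  meaningful value on unbounded sets.
\<close>

definition hausdorff_premeasure :: "real \<Rightarrow> real \<Rightarrow> 'a::metric_space set \<Rightarrow> ennreal" where
  "hausdorff_premeasure s \<delta> A =
     (INF U\<in>{U :: nat \<Rightarrow> 'a set. A \<subseteq> (\<Union>i. U i) \<and> (\<forall>i. bounded (U i) \<and> diameter (U i) \<le> \<delta>)}.
        \<Sum>i. ennreal (diam_pow s (U i)))"

definition hausdorff_measure :: "real \<Rightarrow> 'a::metric_space set \<Rightarrow> ennreal" where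
  "hausdorff_measure s A = (SUP \<delta>\<in>{0<..}. hausdorff_premeasure s \<delta> A)"

definition hausdorff_dim :: "'a::metric_space set \<Rightarrow> ennreal" where
  "hausdorff_dim A = Inf {ennreal s | s. 0 \<le> s \<and> hausdorff_measure s A = 0}"

lemma hausdorff_dim_empty: "hausdorff_dim ({} :: 'a::metric_space set) = 0"
proof -
  have "hausdorff_premeasure 0 \<delta> ({} :: 'a set) = 0" if "\<delta> > 0" for \<delta>
  proof -
    have "hausdorff_premeasure 0 \<delta> ({} :: 'a set) \<le> (\<Sum>i::nat. ennreal (diam_pow 0 ({} :: 'a set)))"
      unfolding hausdorff_premeasure_def using that by (intro INF_lower2[of "\<lambda>_. {}"]) auto
    then show ?thesis
      by (simp add: diam_pow_def)
  qed
  then have "hausdorff_measure 0 ({} :: 'a set) = 0"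
    unfolding hausdorff_measure_def by (simp add: SUP_eq_const)
  then have "ennreal 0 \<in> {ennreal s | s. 0 \<le> s \<and> hausdorff_measure s ({} :: 'a set) = 0}"
    by blast
  then have "hausdorff_dim ({} :: 'a set) \<le> ennreal 0"
    unfolding hausdorff_dim_def by (rule Inf_lower)
  then show ?thesis by simp
qed


section \<open>Birkhoff averages and the dimension spectrum\<close>

definition birkhoff_level :: "cfun \<Rightarrow> real \<Rightarrow> bitseq set" where
  "birkhoff_level f \<alpha> =
     {\<omega>. (\<lambda>N. (1 / real N) * (\<Sum>n=1..N. f ((shift ^^ n) \<omega>))) \<longlonglongrightarrow> \<alpha>}"

definition birkhoff_spectrum :: "cfun \<Rightarrow> real \<Rightarrow> ennreal" where
  "birkhoff_spectrum f \<alpha> = hausdorff_dim (birkhoff_level f \<alpha>)"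

definition alpha_max :: "cfun \<Rightarrow> real" where
  "alpha_max f = Sup {\<alpha>. birkhoff_level f \<alpha> \<noteq> {}}"

text \<open>The supremum is taken over a nonempty set that is bounded above.\<close>

lemma birkhoff_level_nonempty: "{\<alpha>. birkhoff_level f \<alpha> \<noteq> {}} \<noteq> {}"
proof -
  let ?z = "bitseq (\<lambda>_. False)"
  have fixed: "(shift ^^ n) ?z = ?z" for n
    by (induction n) (auto simp: shift_def)
  have "f ?z = (1 / real N) * (\<Sum>n=1..N. f ((shift ^^ n) ?z))" if "N > 0" for N
    using that by (simp add: fixed)
  then have "\<forall>\<^sub>F N in sequentially. (1 / real N) * (\<Sum>n=1..N. f ((shift ^^ n) ?z)) = f ?z"
    unfolding eventually_sequentially by (intro exI[of _ 1]) (metis One_nat_def Suc_le_eq)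
  then have "?z \<in> birkhoff_level f (f ?z)"
    unfolding birkhoff_level_def by (auto intro: tendsto_eventually)
  then show ?thesis by blast
qed

lemma birkhoff_level_bdd_above: "bdd_above {\<alpha>. birkhoff_level f \<alpha> \<noteq> {}}"
proof (rule bdd_aboveI)
  fix \<alpha> assume "\<alpha> \<in> {\<alpha>. birkhoff_level f \<alpha> \<noteq> {}}"
  then obtain \<omega> where *: "(\<lambda>N. (1 / real N) * (\<Sum>n=1..N. f ((shift ^^ n) \<omega>))) \<longlonglongrightarrow> \<alpha>"
    by (auto simp: birkhoff_level_def)
  have "(1 / real N) * (\<Sum>n=1..N. f ((shift ^^ n) \<omega>)) \<le> norm f" for N
  proof (cases "N = 0")
    case False
    have "f ((shift ^^ n) \<omega>) \<le> norm f" for n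
      using norm_bounded[of f "(shift ^^ n) \<omega>"] by simp
    then have "(\<Sum>n=1..N. f ((shift ^^ n) \<omega>)) \<le> real N * norm f"
      using sum_bounded_above[of "{1..N}" "\<lambda>n. f ((shift ^^ n) \<omega>)" "norm f"] by simp
    with False show ?thesis
      by (simp add: field_simps)
  qed simp
  then show "\<alpha> \<le> norm f"
    using LIMSEQ_le_const2[OF *] by blast
qed

end

theory Submission
  imports Defs
begin

text \<open>
  Approximate \<open>f\<close> by a function \<open>g\<close> of finitely many coordinates, and let \<open>b\<close> be almost the
  maximal ergodic average of \<open>g\<close>. Take a long word \<open>w\<close> whose Birkhoff sum is almost maximal,
  and let \<open>X\<close> be the set of sequences composed of blocks \<open>w*\<close> in which the last digit \<open>*\<close> is
  free. Then \<open>X\<close> has positive dimension, and all long Birkhoff averages along orbits of \<open>X\<close>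
  are within a small \<open>c\<close> of \<open>b\<close>. For a suitable function \<open>u\<close> of finitely many coordinates, built
  from minima of Birkhoff sums, \<open>h = min (g + c) (b + u \<circ> shift - u)\<close> satisfies \<open>g \<le> h \<le> g + c\<close>,
  and it equals \<open>b + u \<circ> shift - u\<close> along the orbits of \<open>X\<close>. So \<open>b\<close> is the maximal average of
  \<open>h\<close>, and it is attained on \<open>X\<close>.
\<close>

section \<open>Functions of finitely many coordinates\<close>

text \<open>Stated for bare functions, so that sums, minima and compositions with
  \<open>shift\<close> carry no continuity obligations; \<open>depends_imp_PCC\<close> returns to
  \<open>cfun\<close>.\<close>

definition depends :: "nat \<Rightarrow> (bitseq \<Rightarrow> 'b) \<Rightarrow> bool" where
  "depends k F \<longleftrightarrow> (\<forall>\<omega> \<omega>'. (\<forall>i<k. coord \<omega> i = coord \<omega>' i) \<longrightarrow> F \<omega> = F \<omega>')"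

lemma dependsD: "depends k F \<Longrightarrow> (\<And>i. i < k \<Longrightarrow> coord \<omega> i = coord \<omega>' i) \<Longrightarrow> F \<omega> = F \<omega>'"
  unfolding depends_def by blast

lemma depends_mono: "depends k F \<Longrightarrow> k \<le> l \<Longrightarrow> depends l F"
  unfolding depends_def by (meson order_less_le_trans)

lemma depends_const: "depends k (\<lambda>_. c)"
  unfolding depends_def by simp

lemma depends_comp2: "depends k F \<Longrightarrow> depends l G \<Longrightarrow> depends (max k l) (\<lambda>\<omega>. h (F \<omega>) (G \<omega>))"
  unfolding depends_def by (metis max_less_iff_conj less_max_iff_disj)

lemma coord_shift [simp]: "coord (shift \<omega>) i = coord \<omega> (Suc i)"
  by (simp add: shift_def)

lemma coord_funpow_shift [simp]: "coord ((shift ^^ n) \<omega>) i = coord \<omega> (n + i)"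
  by (induction n arbitrary: i) auto

lemma depends_shift: "depends k F \<Longrightarrow> depends (Suc k) (\<lambda>\<omega>. F (shift \<omega>))"
  unfolding depends_def by (metis Suc_less_eq coord_shift)

lemma dist_bitseq_ge:
  assumes "coord x i \<noteq> coord y i"
  shows "(1/2) ^ Suc i \<le> dist x y"
proof -
  have "sum (\<lambda>k. \<bar>of_bool (coord x k) - of_bool (coord y k)\<bar> * (1/2::real) ^ Suc k) {i} \<le> dist x y"
    unfolding dist_bitseq_def by (rule sum_le_suminf[OF summable_bitseq_dist]) auto
  with assms show ?thesis by (auto simp: of_bool_def split: if_splits)
qed

text \<open>Points at distance less than \<open>(1/2) ^ k\<close> agree in the first
  \<open>k\<close> coordinates, so \<open>F\<close> is locally constant.\<close>

lemma depends_continuous: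
  fixes F :: "bitseq \<Rightarrow> real"
  assumes "depends k F"
  shows "continuous_on UNIV F"
  unfolding continuous_on_iff
proof (intro ballI allI impI)
  fix x and e :: real assume "e > 0"
  have "dist (F y) (F x) < e" if "dist y x < (1/2) ^ k" for y
  proof -
    have "F y = F x"
    proof (rule dependsD[OF assms], rule ccontr)
      fix i assume i: "i < k" "coord y i \<noteq> coord x i"
      have "(1/2::real) ^ k \<le> (1/2) ^ Suc i"
        using i by (intro power_decreasing) auto
      with dist_bitseq_ge[OF i(2)] that show False by linarith
    qed
    with \<open>e > 0\<close> show ?thesis by simp
  qed
  then show "\<exists>d>0. \<forall>x'\<in>UNIV. dist x' x < d \<longrightarrow> dist (F x') (F x) < e"
    by (intro exI[of _ "(1/2) ^ k"]) simp
qed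

lemma depends_bounded:
  fixes F :: "bitseq \<Rightarrow> real"
  assumes "depends k F"
  obtains B where "B \<ge> 0" "\<And>\<omega>. \<bar>F \<omega>\<bar> \<le> B"
proof -
  have "bounded (range F)"
    using continuous_on_imp_bcontfun[OF depends_continuous[OF assms]] by (simp add: bcontfun_def)
  then obtain B where "\<forall>x\<in>range F. norm x \<le> B"
    unfolding bounded_iff by blast
  then have B: "\<bar>F \<omega>\<bar> \<le> B" for \<omega>
    by simp
  show ?thesis
  proof (rule that)
    show "0 \<le> B" using B[of undefined] by linarith
  qed (rule B)
qed

lemma depends_imp_PCC:
  fixes F :: "bitseq \<Rightarrow> real"
  assumes "depends k F"
  obtains h :: cfun where "h \<in> PCC" "\<And>\<omega>. h \<omega> = F \<omega>"
proof -
  have ap: "apply_bcontfun (Bcontfun F) = F"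
    by (rule Bcontfun_inverse[OF continuous_on_imp_bcontfun[OF depends_continuous[OF assms]]])
  \<comment> \<open>\<open>PCC\<close> collects \<open>PCC_at\<close> from index 1 on; raising the
    index excludes 0.\<close>
  have "depends (Suc k) F" using depends_mono[OF assms] by simp
  then have "Bcontfun F \<in> PCC_at (Suc k)"
    unfolding PCC_at_def depends_def ap mem_Collect_eq .
  then have "Bcontfun F \<in> PCC" by (auto simp: PCC_def)
  from this ap[THEN fun_cong] show ?thesis by (rule that)
qed

lemma depends_dense:
  fixes f :: cfun
  assumes "e > 0"
  obtains k and g :: "bitseq \<Rightarrow> real" where "depends k g" "\<And>\<omega>. \<bar>f \<omega> - g \<omega>\<bar> \<le> e"
proof -
  have "continuous_on UNIV f"
    using apply_bcontfun[of f] by (simp add: bcontfun_def)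
  then have "uniformly_continuous_on UNIV f"
    by (rule compact_uniformly_continuous[OF _ compact_UNIV_bitseq])
  then obtain d where d: "d > 0" "\<And>x y. dist x y < d \<Longrightarrow> dist (f x) (f y) < e"
    unfolding uniformly_continuous_on_def using assms by (metis UNIV_I)
  obtain k where k: "(1/2::real) ^ k < d"
    using real_arch_pow_inv[OF d(1), of "1/2"] by auto
  \<comment> \<open>Replacing the tail by zeros moves a point by at most \<open>(1/2) ^ k\<close>,
    which lies below the modulus \<open>d\<close> of uniform continuity.\<close>
  define t where "t = (\<lambda>\<omega>. bitseq (\<lambda>i. i < k \<and> coord \<omega> i))"
  show ?thesis
  proof (rule that)
    show "depends k (\<lambda>\<omega>. f (t \<omega>))"
      unfolding depends_def
    proof (intro allI impI)
      fix \<omega> \<omega>' assume "\<forall>i<k. coord \<omega> i = coord \<omega>' i"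
      then have "(\<lambda>i. i < k \<and> coord \<omega> i) = (\<lambda>i. i < k \<and> coord \<omega>' i)"
        by auto
      then show "f (t \<omega>) = f (t \<omega>')" by (simp only: t_def)
    qed
    fix \<omega>
    have "dist \<omega> (t \<omega>) \<le> (1/2) ^ k"
      by (rule dist_bitseq_le) (simp add: t_def)
    with k d(2)[of \<omega> "t \<omega>"] show "\<bar>f \<omega> - f (t \<omega>)\<bar> \<le> e"
      by (simp add: dist_real_def)
  qed
qed


section \<open>Birkhoff sums and sub-actions\<close>

text \<open>Starting at index 0 gives the cocycle identity \<open>birk_add\<close>. The averages in
  \<open>birkhoff_level\<close> start at 1, whence the \<open>shift\<close> in
  \<open>birkhoff_level_iff\<close>.\<close>

definition birk :: "(bitseq \<Rightarrow> real) \<Rightarrow> nat \<Rightarrow> bitseq \<Rightarrow> real" where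
  "birk a n \<omega> = (\<Sum>i<n. a ((shift ^^ i) \<omega>))"

lemma birk_add: "birk a (m + n) \<omega> = birk a m \<omega> + birk a n ((shift ^^ m) \<omega>)"
  by (induction n) (simp_all add: birk_def funpow_add[unfolded o_def] add.commute[of m])

lemma birk_Suc: "birk a (Suc n) \<omega> = a \<omega> + birk a n (shift \<omega>)"
  using birk_add[of a 1 n \<omega>] by (simp add: birk_def)

lemma birk_coboundary:
  "birk (\<lambda>\<omega>. a \<omega> + u (shift \<omega>) - u \<omega>) n \<omega> = birk a n \<omega> + u ((shift ^^ n) \<omega>) - u \<omega>"
  by (induction n) (simp_all add: birk_def)

lemma birk_affine: "birk (\<lambda>\<omega>. c - a \<omega>) n \<omega> = real n * c - birk a n \<omega>"
  by (simp add: birk_def sum_subtractf)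

lemma birk_mono: "(\<And>\<omega>. a \<omega> \<le> a' \<omega>) \<Longrightarrow> birk a n \<omega> \<le> birk a' n \<omega>"
  unfolding birk_def by (intro sum_mono)

lemma birk_cong_orbit:
  "(\<And>j. a ((shift ^^ j) \<omega>) = a' ((shift ^^ j) \<omega>)) \<Longrightarrow> birk a n \<omega> = birk a' n \<omega>"
  unfolding birk_def by simp

lemma birk_abs_le:
  assumes "\<And>\<omega>. \<bar>a \<omega>\<bar> \<le> B"
  shows "\<bar>birk a n \<omega>\<bar> \<le> real n * B"
  unfolding birk_def using sum_norm_bound[of "{..<n}" "\<lambda>i. a ((shift ^^ i) \<omega>)" B] assms by simp

lemma depends_birk: "depends k a \<Longrightarrow> depends (k + n) (birk a n)"
proof (induction n)
  case 0
  show ?case unfolding birk_def by (simp add: depends_const)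
next
  case (Suc n)
  have "depends (max k (Suc (k + n))) (\<lambda>\<omega>. a \<omega> + birk a n (shift \<omega>))"
    by (rule depends_comp2[OF Suc.prems depends_shift[OF Suc.IH[OF Suc.prems]]])
  also have "(\<lambda>\<omega>. a \<omega> + birk a n (shift \<omega>)) = birk a (Suc n)"
    by (rule ext) (rule birk_Suc[symmetric])
  finally show ?case by (simp add: max_absorb2)
qed

text \<open>\<open>min_birk a M\<close> is the minimum of the Birkhoff sums \<open>birk a n\<close> over \<open>0 \<le> n \<le> M\<close>.\<close>

fun min_birk :: "(bitseq \<Rightarrow> real) \<Rightarrow> nat \<Rightarrow> bitseq \<Rightarrow> real" where
  "min_birk a 0 \<omega> = 0"
| "min_birk a (Suc M) \<omega> = min 0 (a \<omega> + min_birk a M (shift \<omega>))"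

lemma min_birk_nonpos: "min_birk a M \<omega> \<le> 0"
  by (cases M) auto

text \<open>The recursion prepends a step to the orbit segments, whereas here only the longest sum
  is new. The two descriptions agree because adding \<open>a \<omega>\<close> commutes with
  minima.\<close>

lemma min_birk_Suc: "min_birk a (Suc M) \<omega> = min (min_birk a M \<omega>) (birk a (Suc M) \<omega>)"
proof (induction M arbitrary: \<omega>)
  case (Suc M)
  have "min_birk a (Suc (Suc M)) \<omega> = min 0 (a \<omega> + min_birk a (Suc M) (shift \<omega>))"
    by simp
  also have "\<dots> = min (min_birk a (Suc M) \<omega>) (a \<omega> + birk a (Suc M) (shift \<omega>))"
    using Suc.IH[of "shift \<omega>"] min_birk.simps(2)[of a M \<omega>] by linarith
  finally show ?case by (simp only: birk_Suc[of a "Suc M"])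
qed (simp add: birk_def)

text \<open>A nonnegative longest sum cannot lower a minimum that is already \<le> 0, so the minima
  for \<open>M\<close> and \<open>Suc M\<close> coincide at \<open>\<omega>\<close>. With
  \<open>u = min_birk a M\<close>, the function \<open>a + u \<circ> shift - u\<close> is then
  nonnegative at \<open>\<omega>\<close>.\<close>

lemma min_birk_le:
  assumes "birk a (Suc M) \<omega> \<ge> 0"
  shows "min_birk a M \<omega> \<le> a \<omega> + min_birk a M (shift \<omega>)"
  using min_birk_Suc[of a M \<omega>] assms min_birk_nonpos[of a M \<omega>] by (auto simp: min_def split: if_splits)

lemma min_birk_ge: "min_birk a M \<omega> \<ge> min 0 (a \<omega> + min_birk a M (shift \<omega>))"
  using min_birk_Suc[of a M \<omega>] by (auto simp: min_def split: if_splits)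

lemma depends_min_birk: "depends k a \<Longrightarrow> depends (k + M) (min_birk a M)"
proof (induction M)
  case 0
  have "min_birk a 0 = (\<lambda>_. 0)" by (rule ext) simp
  then show ?case by (simp add: depends_const)
next
  case (Suc M)
  have "depends (max k (Suc (k + M))) (\<lambda>\<omega>. min 0 (a \<omega> + min_birk a M (shift \<omega>)))"
    by (rule depends_comp2[OF Suc.prems depends_shift[OF Suc.IH[OF Suc.prems]]])
  also have "(\<lambda>\<omega>. min 0 (a \<omega> + min_birk a M (shift \<omega>))) = min_birk a (Suc M)"
    by (rule ext) simp
  finally show ?case by (simp add: max_absorb2)
qed

section \<open>Maximal averages from coboundary bounds\<close>

lemma birkhoff_level_iff:
  "\<omega> \<in> birkhoff_level h \<alpha> \<longleftrightarrow> (\<lambda>N. birk h N (shift \<omega>) / real N) \<longlonglongrightarrow> \<alpha>"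
proof -
  have "(\<Sum>n=1..N. h ((shift ^^ n) \<omega>)) = birk h N (shift \<omega>)" for N
    unfolding birk_def
  proof (rule sum.reindex_bij_witness[of _ Suc "\<lambda>n. n - 1"])
    fix n assume "n \<in> {1..N}"
    then obtain m where "n = Suc m" by (cases n) auto
    then show "h ((shift ^^ (n - 1)) (shift \<omega>)) = h ((shift ^^ n) \<omega>)"
      by (simp add: funpow_swap1)
  qed auto
  then show ?thesis by (simp add: birkhoff_level_def)
qed

text \<open>The sum telescopes to \<open>N * b\<close> plus a boundary term of absolute value at
  most \<open>2 * B\<close>.\<close>

lemma coboundary_average_tendsto:
  assumes "\<And>\<omega>. \<bar>u \<omega>\<bar> \<le> B"
  shows "(\<lambda>N. birk (\<lambda>\<omega>. b + u (shift \<omega>) - u \<omega>) N \<omega> / real N) \<longlonglongrightarrow> b"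
proof -
  have "(\<lambda>N. (u ((shift ^^ N) \<omega>) - u \<omega>) / real N) \<longlonglongrightarrow> 0"
  proof (rule Lim_null_comparison)
    show "(\<lambda>N. 2 * B / real N) \<longlonglongrightarrow> 0"
      by (rule lim_const_over_n)
    have "\<bar>u ((shift ^^ N) \<omega>) - u \<omega>\<bar> \<le> 2 * B" for N
      using assms[of \<omega>] assms[of "(shift ^^ N) \<omega>"] by linarith
    then show "\<forall>\<^sub>F N in sequentially. norm ((u ((shift ^^ N) \<omega>) - u \<omega>) / real N) \<le> 2 * B / real N"
      by (intro always_eventually allI) (simp add: divide_right_mono)
  qed
  then have "(\<lambda>N. b + (u ((shift ^^ N) \<omega>) - u \<omega>) / real N) \<longlonglongrightarrow> b + 0"
    by (intro tendsto_intros)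
  moreover have "\<forall>\<^sub>F N in sequentially. b + (u ((shift ^^ N) \<omega>) - u \<omega>) / real N =
      birk (\<lambda>\<omega>. b + u (shift \<omega>) - u \<omega>) N \<omega> / real N"
    \<comment> \<open>At \<open>N = 0\<close> the right-hand quotient is 0 by the convention for
      division by 0.\<close>
    using eventually_gt_at_top[of 0]
  proof eventually_elim
    case (elim N)
    then show ?case
      using birk_coboundary[of "\<lambda>_. b" u N \<omega>] by (simp add: birk_def field_simps)
  qed
  ultimately show ?thesis
    using Lim_transform_eventually by fastforce
qed

text \<open>The coboundary bound caps all limits of averages by \<open>b\<close>, and equality along
  the orbits of \<open>X\<close> makes \<open>b\<close> a value that is attained.\<close>

lemma alpha_max_eqI:
  fixes h :: cfun
  assumes bd: "\<And>\<omega>. \<bar>u \<omega>\<bar> \<le> B"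
    and le: "\<And>\<omega>. h \<omega> \<le> b + u (shift \<omega>) - u \<omega>"
    and eq: "\<And>x j. x \<in> X \<Longrightarrow> h ((shift ^^ j) x) = b + u (shift ((shift ^^ j) x)) - u ((shift ^^ j) x)"
    and "X \<noteq> {}"
  shows "alpha_max h = b" "X \<subseteq> birkhoff_level h b"
proof -
  note lim = coboundary_average_tendsto[of u B b, OF bd]
  show sub: "X \<subseteq> birkhoff_level h b"
  proof
    fix x assume "x \<in> X"
    have "birk h N (shift x) = birk (\<lambda>\<omega>. b + u (shift \<omega>) - u \<omega>) N (shift x)" for N
      using eq[OF \<open>x \<in> X\<close>, of "Suc _"] by (intro birk_cong_orbit) (simp add: funpow_swap1)
    with lim[of "shift x"] show "x \<in> birkhoff_level h b"
      by (simp add: birkhoff_level_iff)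
  qed
  show "alpha_max h = b"
    unfolding alpha_max_def
  proof (rule cSup_eq_maximum)
    show "b \<in> {\<alpha>. birkhoff_level h \<alpha> \<noteq> {}}"
      using sub \<open>X \<noteq> {}\<close> by blast
    fix \<alpha> assume "\<alpha> \<in> {\<alpha>. birkhoff_level h \<alpha> \<noteq> {}}"
    then obtain \<omega> where "\<omega> \<in> birkhoff_level h \<alpha>" by blast
    then have "(\<lambda>N. birk h N (shift \<omega>) / real N) \<longlonglongrightarrow> \<alpha>"
      by (simp add: birkhoff_level_iff)
    then show "\<alpha> \<le> b"
      by (rule LIMSEQ_le[OF _ lim[of "shift \<omega>"]])
         (auto intro!: divide_right_mono birk_mono le)
  qed
qed

text \<open>
  The first sub-action \<open>\<psi>\<close> bounds \<open>g\<close> by \<open>b\<close> up to a coboundary, with a defect \<open>D \<ge> 0\<close>. The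
  second one, \<open>\<phi>\<close>, spreads this defect along the orbits in \<open>X\<close>, so that each step carries at
  most \<open>c\<close> of it, without making it negative anywhere.
\<close>

lemma flattening_perturbation:
  assumes g: "depends k g"
    and b: "n > 0" "\<And>\<omega>. birk g n \<omega> \<le> real n * b"
    and "c > 0"
    and X: "\<And>K. \<exists>L>0. \<forall>x\<in>X. \<forall>j. birk g L ((shift ^^ j) x) \<ge> real L * (b - c) + K"
    and "X \<noteq> {}"
  obtains h :: cfun where "h \<in> PCC" "\<And>\<omega>. \<bar>h \<omega> - g \<omega>\<bar> \<le> c"
    "alpha_max h = b" "X \<subseteq> birkhoff_level h b"
proof -
  obtain M where M: "n = Suc M" using b(1) by (cases n) auto
  define \<psi> where "\<psi> = min_birk (\<lambda>\<omega>. b - g \<omega>) M"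
  define D where "D = (\<lambda>\<omega>. b - g \<omega> + \<psi> (shift \<omega>) - \<psi> \<omega>)"
  have "\<exists>l. depends l (\<lambda>\<omega>. b - g \<omega>)"
    using depends_comp2[OF depends_const g, of 0 "\<lambda>x y. x - y" b] by blast
  then obtain l0 where l0: "depends l0 (\<lambda>\<omega>. b - g \<omega>)" by blast
  then have \<psi>: "depends (l0 + M) \<psi>"
    unfolding \<psi>_def by (rule depends_min_birk)
  obtain K where K: "K \<ge> 0" "\<And>\<omega>. \<bar>\<psi> \<omega>\<bar> \<le> K" by (rule depends_bounded[OF \<psi>]) blast
  have D0: "D \<omega> \<ge> 0" for \<omega>
    using min_birk_le[of "\<lambda>\<omega>. b - g \<omega>" M \<omega>] b(2)[of \<omega>]
    by (simp add: D_def \<psi>_def birk_affine M)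
  have "\<exists>l. depends l (\<lambda>\<omega>. c - D \<omega>)"
    unfolding D_def
    using depends_comp2[OF depends_comp2[OF l0 depends_shift[OF \<psi>], of "\<lambda>x y. x + y"] \<psi>,
        of "\<lambda>x y. c - (x - y)"] by blast
  then obtain l1 where l1: "depends l1 (\<lambda>\<omega>. c - D \<omega>)" by blast
  \<comment> \<open>The surplus \<open>2 * K\<close> pays for the two boundary values of
    \<open>\<psi>\<close>, so \<open>birk D L\<close> is at most \<open>L * c\<close> along the
    orbits of \<open>X\<close>.\<close>
  obtain L where L: "L > 0" "\<And>x j. x \<in> X \<Longrightarrow> birk g L ((shift ^^ j) x) \<ge> real L * (b - c) + 2 * K"
    using X[of "2 * K"] by blast
  obtain M' where M': "L = Suc M'" using L(1) by (cases L) auto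
  \<comment> \<open>This is the largest excess of accumulated defect over an allowance of
    \<open>c\<close> per step, over at most \<open>M'\<close> steps.\<close>
  define \<phi> where "\<phi> = (\<lambda>\<omega>. - min_birk (\<lambda>\<omega>. c - D \<omega>) M' \<omega>)"
  \<comment> \<open>The redistributed defect stays nonnegative everywhere, which gives
    \<open>h \<ge> g\<close> below.\<close>
  have \<phi>_sub: "\<phi> \<omega> \<le> D \<omega> + \<phi> (shift \<omega>)" for \<omega>
    using min_birk_ge[of "\<lambda>\<omega>. c - D \<omega>" \<omega> M'] min_birk_nonpos[of "\<lambda>\<omega>. c - D \<omega>" M' "shift \<omega>"]
      D0[of \<omega>] \<open>c > 0\<close> by (auto simp: \<phi>_def min_def split: if_splits)
  have \<phi>_X: "D \<omega> + \<phi> (shift \<omega>) - \<phi> \<omega> \<le> c" if "x \<in> X" "\<omega> = (shift ^^ j) x" for x j \<omega>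
  proof -
    have "birk D L \<omega> = birk (\<lambda>\<omega>. b - g \<omega>) L \<omega> + \<psi> ((shift ^^ L) \<omega>) - \<psi> \<omega>"
      unfolding D_def by (rule birk_coboundary)
    also have "\<dots> \<le> real L * b - (real L * (b - c) + 2 * K) + K + K"
      using L(2)[OF that(1), of j] K(2)[of "(shift ^^ L) \<omega>"] K(2)[of \<omega>]
      unfolding birk_affine that(2) by linarith
    finally have "birk (\<lambda>\<omega>. c - D \<omega>) (Suc M') \<omega> \<ge> 0"
      unfolding birk_affine M'[symmetric] by (simp add: algebra_simps)
    from min_birk_le[OF this] show ?thesis by (simp add: \<phi>_def)
  qed
  define u where "u = (\<lambda>\<omega>. \<psi> \<omega> + \<phi> \<omega>)"
  have "\<exists>l. depends l u"
    unfolding u_def \<phi>_def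
    using depends_comp2[OF \<psi> depends_min_birk[OF l1], where h = "\<lambda>x y. x + - y"] by blast
  then obtain l2 where u: "depends l2 u" by blast
  \<comment> \<open>Cutting at \<open>g + c\<close> keeps \<open>h\<close> close to
    \<open>g\<close>; along the orbits of \<open>X\<close> the cut is inactive by
    \<open>\<phi>_X\<close>.\<close>
  have "\<exists>l. depends l (\<lambda>\<omega>. min (g \<omega> + c) (b + u (shift \<omega>) - u \<omega>))"
    using depends_comp2[OF g depends_comp2[OF depends_shift[OF u] u, of "\<lambda>x y. b + x - y"],
        of "\<lambda>x y. min (x + c) y"] by blast
  then obtain l3 where "depends l3 (\<lambda>\<omega>. min (g \<omega> + c) (b + u (shift \<omega>) - u \<omega>))" by blast
  then obtain h :: cfun where h: "h \<in> PCC" "\<And>\<omega>. h \<omega> = min (g \<omega> + c) (b + u (shift \<omega>) - u \<omega>)"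
    by (rule depends_imp_PCC) blast
  have u_D: "b + u (shift \<omega>) - u \<omega> = g \<omega> + (D \<omega> + \<phi> (shift \<omega>) - \<phi> \<omega>)" for \<omega>
    by (simp add: u_def D_def)
  obtain B where B: "\<And>\<omega>. \<bar>u \<omega>\<bar> \<le> B" using depends_bounded[OF u] by blast
  have 1: "h \<omega> \<le> b + u (shift \<omega>) - u \<omega>" for \<omega>
    by (simp add: h(2))
  have 2: "h ((shift ^^ j) x) = b + u (shift ((shift ^^ j) x)) - u ((shift ^^ j) x)" if "x \<in> X" for x j
    unfolding h(2) u_D using \<phi>_X[OF that refl, of j] by simp
  show ?thesis
  proof (rule that[OF h(1)])
    fix \<omega> show "\<bar>h \<omega> - g \<omega>\<bar> \<le> c"
      unfolding h(2) u_D using \<phi>_sub[of \<omega>] \<open>c > 0\<close> by (auto simp: min_def)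
  qed (use alpha_max_eqI[OF B 1 2 \<open>X \<noteq> {}\<close>] in auto)
qed


section \<open>Sequences with one free digit per block\<close>

text \<open>For \<open>p > 0\<close> the free positions are those congruent to \<open>p - 1\<close>
  modulo \<open>p\<close>, and \<open>w\<close> is read only at indices below
  \<open>p - 1\<close>.\<close>

definition free_digit_set :: "(nat \<Rightarrow> bool) \<Rightarrow> nat \<Rightarrow> bitseq set" where
  "free_digit_set w p = {x. \<forall>i. Suc (i mod p) \<noteq> p \<longrightarrow> coord x i = w (i mod p)}"

lemma binary_expansion:
  fixes t :: real
  assumes "0 \<le> t" "t < 1"
  obtains y where "dist y (bitseq (\<lambda>_. False)) = t"
proof -
  define y where "y = bitseq (\<lambda>k. odd \<lfloor>t * 2 ^ Suc k\<rfloor>)"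
  \<comment> \<open>The partial sums are the dyadic truncations of \<open>t\<close>; the case
    \<open>m = 0\<close> is where \<open>0 \<le> t < 1\<close> enters.\<close>
  have part: "(\<Sum>k<m. of_bool (coord y k) * (1/2::real) ^ Suc k) = of_int \<lfloor>t * 2 ^ m\<rfloor> / 2 ^ m" for m
  proof (induction m)
    case 0
    then show ?case using assms by (simp add: floor_eq_iff)
  next
    case (Suc m)
    let ?a = "\<lfloor>t * 2 ^ Suc m\<rfloor>"
    have "\<lfloor>t * 2 ^ m\<rfloor> = ?a div 2"
    proof -
      have "\<lfloor>t * 2 ^ Suc m / 2\<rfloor> = ?a div 2"
        using floor_divide_real_eq_div[of 2 "t * 2 ^ Suc m"] by simp
      then show ?thesis by simp
    qed
    moreover have "real_of_int a = 2 * of_int (a div 2) + of_bool (odd a)" for a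
      by (cases "even a") (auto elim!: evenE oddE)
    note this[of ?a]
    ultimately show ?case
      using Suc.IH by (simp add: y_def field_simps)
  qed
  have "(\<lambda>m. of_int \<lfloor>t * 2 ^ m\<rfloor> / 2 ^ m - t) \<longlonglongrightarrow> 0"
  proof (rule Lim_null_comparison)
    show "(\<lambda>m. (1/2::real) ^ m) \<longlonglongrightarrow> 0" by (rule LIMSEQ_power_zero) simp
    have "\<bar>of_int \<lfloor>t * 2 ^ m\<rfloor> / 2 ^ m - t\<bar> \<le> (1/2) ^ m" for m
    proof -
      have "of_int \<lfloor>t * 2 ^ m\<rfloor> / 2 ^ m - t = (of_int \<lfloor>t * 2 ^ m\<rfloor> - t * 2 ^ m) / 2 ^ m"
        by (simp add: field_simps)
      also have "\<bar>\<dots>\<bar> \<le> 1 / 2 ^ m"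
        unfolding abs_divide by (intro frac_le) (auto intro: less_imp_le, linarith)
      finally show ?thesis by (simp add: power_divide)
    qed
    then show "\<forall>\<^sub>F m in sequentially. norm (of_int \<lfloor>t * 2 ^ m\<rfloor> / 2 ^ m - t) \<le> (1/2) ^ m"
      by simp
  qed
  then have "(\<lambda>m. of_int \<lfloor>t * 2 ^ m\<rfloor> / 2 ^ m) \<longlonglongrightarrow> t"
    by (simp add: LIM_zero_cancel)
  then have "(\<lambda>k. of_bool (coord y k) * (1/2::real) ^ Suc k) sums t"
    unfolding sums_def part .
  then have "dist y (bitseq (\<lambda>_. False)) = t"
    unfolding dist_bitseq_def by (simp add: sums_iff)
  then show ?thesis by (rule that)
qed

text \<open>The free digits read as a binary expansion, whose value is the distance to the zero
  sequence.\<close>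

definition free_value :: "nat \<Rightarrow> bitseq \<Rightarrow> real" where
  "free_value p x = dist (bitseq (\<lambda>j. coord x (p * j + (p - 1)))) (bitseq (\<lambda>_. False))"

lemma free_value_surj:
  assumes "p > 0" "0 \<le> t" "t < 1"
  shows "t \<in> free_value p ` free_digit_set w p"
proof -
  obtain y where y: "dist y (bitseq (\<lambda>_. False)) = t"
    using binary_expansion assms by blast
  define x where "x = bitseq (\<lambda>i. if Suc (i mod p) = p then coord y (i div p) else w (i mod p))"
  have *: "Suc ((p * j + (p - 1)) mod p) = p" "(p * j + (p - 1)) div p = j" for j
    using \<open>p > 0\<close> by (simp_all only: mod_mult_self4 div_mult_self4) simp_all
  have "bitseq (\<lambda>j. coord x (p * j + (p - 1))) = y"
    unfolding x_def coord_bitseq * by (simp add: coord_inverse)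
  then have "free_value p x = t" by (simp add: free_value_def y)
  moreover have "x \<in> free_digit_set w p"
    by (auto simp: free_digit_set_def x_def)
  ultimately show ?thesis by blast
qed

text \<open>The first disagreement of \<open>x\<close> and \<open>y\<close> is at a free position
  \<open>i\<close>, with \<open>i + 1\<close> a multiple of \<open>p\<close>. The free digits before
  it agree, and the distance is at least \<open>(1/2) ^ Suc i\<close>; taking the
  \<open>p\<close>-th root gives the exponent.\<close>

lemma free_value_hoelder:
  assumes "p > 0" and x: "x \<in> free_digit_set w p" and y: "y \<in> free_digit_set w p"
  shows "\<bar>free_value p x - free_value p y\<bar> \<le> 2 * dist x y powr (1 / real p)"
proof (cases "x = y")
  case False
  define i where "i = (LEAST i. coord x i \<noteq> coord y i)"
  have "\<exists>i. coord x i \<noteq> coord y i"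
    using False coord_inject[of x y] by (auto simp: fun_eq_iff)
  then have i: "coord x i \<noteq> coord y i"
    unfolding i_def by (rule LeastI_ex)
  have less: "coord x l = coord y l" if "l < i" for l
    using not_less_Least[of l "\<lambda>i. coord x i \<noteq> coord y i"] that by (auto simp: i_def)
  have "Suc (i mod p) = p"
    using x y i by (auto simp: free_digit_set_def)
  then have Suc_i: "Suc i = p * Suc (i div p)"
    by (metis add_Suc_right mult_Suc_right mult_div_mod_eq add.commute)
  have "\<bar>free_value p x - free_value p y\<bar> \<le>
      dist (bitseq (\<lambda>j. coord x (p * j + (p - 1)))) (bitseq (\<lambda>j. coord y (p * j + (p - 1))))"
    unfolding free_value_def by (metis abs_dist_diff_le dist_commute)
  also have "\<dots> \<le> (1/2) ^ (i div p)"
  proof (rule dist_bitseq_le)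
    fix j assume "j < i div p"
    then have "p * Suc j \<le> p * (i div p)" by (intro mult_le_mono2) simp
    then have "p * j + (p - 1) < i"
      using Suc_i \<open>p > 0\<close> by simp
    then show "coord (bitseq (\<lambda>j. coord x (p * j + (p - 1)))) j = coord (bitseq (\<lambda>j. coord y (p * j + (p - 1)))) j"
      by (simp add: less)
  qed
  also have "\<dots> = 2 * ((1/2) ^ Suc i) powr (1 / real p)"
  proof -
    have "((1/2::real) ^ Suc i) powr (1 / real p) = (1/2) powr (real (Suc i) * (1 / real p))"
      by (subst powr_realpow[symmetric]) (simp_all add: powr_powr)
    also have "real (Suc i) * (1 / real p) = real (Suc (i div p))"
      unfolding Suc_i of_nat_mult using \<open>p > 0\<close> by (simp del: of_nat_Suc)
    finally show ?thesis by (subst (asm) powr_realpow) simp_all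
  qed
  also have "\<dots> \<le> 2 * dist x y powr (1 / real p)"
    using dist_bitseq_ge[OF i] by (intro mult_left_mono powr_mono2) auto
  finally show ?thesis .
qed simp

section \<open>Lower bounds for the Hausdorff dimension\<close>

lemma diam_pow_ge:
  assumes "U \<noteq> {}" "diameter U \<le> 1" "bounded U" "0 \<le> s" "s \<le> s0" "s0 > 0"
  shows "diameter U powr s0 \<le> diam_pow s U"
proof -
  have "0 \<le> diameter U" by (rule diameter_ge_0[OF assms(3)])
  then show ?thesis
    using assms by (auto simp: diam_pow_def powr_mono' powr_le1)
qed

text \<open>A cover of \<open>E\<close> maps to a cover of the unit interval by sets of length at
  most \<open>2 * C\<close> times a power of the diameters, so the sums of these powers stay above
  \<open>1 / (2 * C)\<close>.\<close>

lemma hausdorff_dim_ge_hoelder: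
  fixes F :: "'a::metric_space \<Rightarrow> real"
  assumes surj: "{0..<1} \<subseteq> F ` X" and "s0 > 0" "C > 0"
    and hoelder: "\<And>x y. x \<in> X \<Longrightarrow> y \<in> X \<Longrightarrow> \<bar>F x - F y\<bar> \<le> C * dist x y powr s0"
    and "X \<subseteq> E"
  shows "hausdorff_dim E \<ge> ennreal s0"
  unfolding hausdorff_dim_def
proof (rule Inf_greatest, clarify)
  fix s :: real assume s: "0 \<le> s" "hausdorff_measure s E = 0"
  show "ennreal s0 \<le> ennreal s"
  proof (rule ccontr)
    assume "\<not> ?thesis"
    then have "s \<le> s0"
      using ennreal_leI linear by blast
    \<comment> \<open>At scale 1 all diameters are at most 1, so the power with exponent
      \<open>s0\<close> is bounded by the one with exponent \<open>s\<close>.\<close>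
    have "ennreal (1 / (2 * C)) \<le> hausdorff_premeasure s 1 E"
      unfolding hausdorff_premeasure_def
    proof (rule INF_greatest, clarify)
      fix U :: "nat \<Rightarrow> 'a set"
      assume cover: "E \<subseteq> (\<Union>i. U i)" and U: "\<forall>i. bounded (U i) \<and> diameter (U i) \<le> 1"
      \<comment> \<open>The images are enclosed in measurable intervals centred at one image point,
        hence the factor 2.\<close>
      have "\<exists>I. I \<in> sets lborel \<and> F ` (U i \<inter> X) \<subseteq> I \<and> emeasure lborel I \<le> ennreal (2 * C) * ennreal (diam_pow s (U i))" for i
      proof (cases "U i \<inter> X = {}")
        case True
        then show ?thesis by (intro exI[of _ "{}"]) auto
      next
        case False
        then obtain x where x: "x \<in> U i" "x \<in> X" by blast
        define r where "r = C * diameter (U i) powr s0"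
        have "r \<ge> 0" using \<open>C > 0\<close> by (simp add: r_def)
        have "F y \<in> {F x - r..F x + r}" if "y \<in> U i" "y \<in> X" for y
        proof -
          have "dist x y \<le> diameter (U i)"
            using U x that by (intro diameter_bounded_bound) auto
          then have "C * dist x y powr s0 \<le> r"
            unfolding r_def using \<open>C > 0\<close> \<open>s0 > 0\<close> by (intro mult_left_mono powr_mono2) auto
          with hoelder[OF x(2) that(2)] show ?thesis by auto
        qed
        moreover have "emeasure lborel {F x - r..F x + r} \<le> ennreal (2 * C) * ennreal (diam_pow s (U i))"
        proof -
          have "emeasure lborel {F x - r..F x + r} = ennreal (2 * r)"
            using \<open>r \<ge> 0\<close> by simp
          also have "\<dots> \<le> ennreal (2 * C * diam_pow s (U i))"
            using diam_pow_ge[of "U i" s s0] x U s(1) \<open>s \<le> s0\<close> \<open>s0 > 0\<close> \<open>C > 0\<close>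
            by (intro ennreal_leI) (auto simp: r_def)
          also have "\<dots> = ennreal (2 * C) * ennreal (diam_pow s (U i))"
            using \<open>C > 0\<close> by (intro ennreal_mult) (auto simp: diam_pow_def)
          finally show ?thesis .
        qed
        ultimately show ?thesis by (intro exI[of _ "{F x - r..F x + r}"]) auto
      qed
      then obtain I where I: "\<And>i. I i \<in> sets lborel" "\<And>i. F ` (U i \<inter> X) \<subseteq> I i"
        "\<And>i. emeasure lborel (I i) \<le> ennreal (2 * C) * ennreal (diam_pow s (U i))"
        by metis
      have "{0..<1} \<subseteq> (\<Union>i. I i)"
      proof
        fix t :: real assume "t \<in> {0..<1}"
        then obtain x where "x \<in> X" "t = F x" using surj by blast
        moreover from this obtain i where "x \<in> U i" using cover \<open>X \<subseteq> E\<close> by blast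
        ultimately show "t \<in> (\<Union>i. I i)" using I(2)[of i] by blast
      qed
      then have "emeasure lborel {0..<1::real} \<le> emeasure lborel (\<Union>i. I i)"
        using I(1) by (intro emeasure_mono) auto
      also have "\<dots> \<le> (\<Sum>i. emeasure lborel (I i))"
        using I(1) by (intro emeasure_subadditive_countably) auto
      also have "\<dots> \<le> (\<Sum>i. ennreal (2 * C) * ennreal (diam_pow s (U i)))"
        using I(3) by (intro suminf_le) auto
      also have "\<dots> = ennreal (2 * C) * (\<Sum>i. ennreal (diam_pow s (U i)))"
        by simp
      finally have "1 \<le> ennreal (2 * C) * (\<Sum>i. ennreal (diam_pow s (U i)))"
        by simp
      then have "ennreal (1 / (2 * C)) * 1 \<le> ennreal (1 / (2 * C)) * (ennreal (2 * C) * (\<Sum>i. ennreal (diam_pow s (U i))))"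
        by (rule mult_left_mono) simp
      also have "\<dots> = (\<Sum>i. ennreal (diam_pow s (U i)))"
        using \<open>C > 0\<close> by (simp add: mult.assoc[symmetric] ennreal_mult[symmetric])
      finally show "ennreal (1 / (2 * C)) \<le> (\<Sum>i. ennreal (diam_pow s (U i)))" by simp
    qed
    also have "\<dots> \<le> hausdorff_measure s E"
      unfolding hausdorff_measure_def by (rule SUP_upper) simp
    finally show False using s(2) \<open>C > 0\<close> by simp
  qed
qed

text \<open>From a block boundary the block estimates add up. Any other start is moved to the next
  boundary, at the cost of two sums of at most \<open>p\<close> terms.\<close>

lemma birk_free_digit_set:
  assumes B: "\<And>\<omega>. \<bar>g \<omega>\<bar> \<le> B" and "p > 0"
    and block: "\<And>y. y \<in> free_digit_set w p \<Longrightarrow> birk g p y \<ge> real p * \<beta>"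
    and x: "x \<in> free_digit_set w p"
  shows "birk g (p * q) ((shift ^^ j) x) \<ge> real (p * q) * \<beta> - 2 * real p * B"
proof -
  have inv: "(shift ^^ (p * t)) y \<in> free_digit_set w p" if "y \<in> free_digit_set w p" for t y
    using that by (simp add: free_digit_set_def)
  have aligned: "birk g (p * q) y \<ge> real (p * q) * \<beta>" if "y \<in> free_digit_set w p" for y
    using that
  proof (induction q arbitrary: y)
    case (Suc q)
    have "birk g (p * Suc q) y = birk g p y + birk g (p * q) ((shift ^^ p) y)"
      using birk_add[of g p "p * q" y] by simp
    with block[OF Suc.prems] Suc.IH[OF inv[OF Suc.prems, of 1]] show ?case
      by (simp add: algebra_simps)
  qed (simp add: birk_def)
  \<comment> \<open>If \<open>j\<close> is a multiple of \<open>p\<close>, then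
    \<open>r = p\<close>: the next boundary lies strictly after \<open>j\<close>.\<close>
  define r where "r = p - j mod p"
  have r: "r \<le> p" "j + r = p * Suc (j div p)"
  proof -
    have "p * (j div p) + j mod p = j" "j mod p < p"
      using \<open>p > 0\<close> by simp_all
    then show "j + r = p * Suc (j div p)"
      unfolding r_def mult_Suc_right by linarith
  qed (simp add: r_def)
  let ?y = "(shift ^^ j) x"
  have "birk g (p * q) ?y + birk g r ((shift ^^ (p * q)) ?y) = birk g r ?y + birk g (p * q) ((shift ^^ r) ?y)"
    using birk_add[of g "p * q" r ?y] birk_add[of g r "p * q" ?y] by (simp add: add.commute)
  moreover have "(shift ^^ r) ?y = (shift ^^ (p * Suc (j div p))) x"
    using r(2) by (metis add.commute comp_apply funpow_add)
  moreover have "\<bar>birk g r \<omega>\<bar> \<le> real p * B" for \<omega>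
  proof -
    have "B \<ge> 0" using B[of undefined] by linarith
    then have "real r * B \<le> real p * B" using r(1) by (intro mult_right_mono) auto
    with birk_abs_le[of g B r \<omega>] B show ?thesis by fastforce
  qed
  note this[of ?y] this[of "(shift ^^ (p * q)) ?y"]
  moreover note aligned[OF inv[OF x, of "Suc (j div p)"]]
  ultimately show ?thesis by simp
qed


section \<open>Density\<close>

lemma exists_perturbation:
  assumes g: "depends k g" and "e > 0"
  obtains h :: cfun where "h \<in> PCC" "\<And>\<omega>. \<bar>h \<omega> - g \<omega>\<bar> \<le> 4 * e"
    "birkhoff_spectrum h (alpha_max h) > 0"
proof -
  obtain B where B: "B \<ge> 0" "\<And>\<omega>. \<bar>g \<omega>\<bar> \<le> B" by (rule depends_bounded[OF g]) blast
  \<comment> \<open>The infimum of \<open>Q\<close> is the maximal ergodic average of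
    \<open>g\<close>.\<close>
  define Q where "Q = {b. \<exists>n>0. \<forall>\<omega>. birk g n \<omega> \<le> real n * b}"
  have birk_B: "\<bar>birk g n \<omega>\<bar> \<le> real n * B" for n \<omega>
    by (rule birk_abs_le[OF B(2)])
  have "B \<in> Q"
    unfolding Q_def using birk_B[of 1] by (auto intro!: exI[of _ "1::nat"] simp: abs_le_iff)
  have "bdd_below Q"
  proof (rule bdd_belowI)
    fix b assume "b \<in> Q"
    then obtain n where n: "n > 0" "\<And>\<omega>. birk g n \<omega> \<le> real n * b" by (auto simp: Q_def)
    have "real n * (- B) \<le> real n * b"
      using birk_B[of n undefined] n(2)[of undefined] by simp
    then show "- B \<le> b" using n(1) by (simp only: mult_le_cancel_left_pos of_nat_0_less_iff)
  qed
  obtain b where b: "b \<in> Q" "b < Inf Q + e"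
    using cInf_lessD[of Q "Inf Q + e"] \<open>B \<in> Q\<close> \<open>e > 0\<close> by auto
  obtain n0 where n0: "n0 > 0" "\<And>\<omega>. birk g n0 \<omega> \<le> real n0 * b"
    using b(1) by (auto simp: Q_def)
  \<comment> \<open>The length is chosen so that \<open>n * e\<close> absorbs the last
    \<open>Suc k\<close> terms of a block.\<close>
  obtain n' where n': "real n' * e > real (Suc k) * (B + \<bar>b - 3 * e\<bar>)"
    using reals_Archimedean3[OF \<open>e > 0\<close>] by blast
  define n where "n = Suc n'"
  have n: "n > 0" "real n * e \<ge> real (Suc k) * (B + \<bar>b - 3 * e\<bar>)"
    using n' \<open>e > 0\<close> by (auto simp: n_def algebra_simps)
  have "Inf Q - e \<notin> Q"
    using cInf_lower[OF _ \<open>bdd_below Q\<close>, of "Inf Q - e"] \<open>e > 0\<close> by auto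
  then obtain \<omega> where "birk g n \<omega> > real n * (Inf Q - e)"
    using n(1) unfolding Q_def mem_Collect_eq by (meson not_le)
  moreover have "real n * (Inf Q - e) \<ge> real n * (b - 2 * e)"
    using b(2) by (intro mult_left_mono) auto
  ultimately have \<omega>: "birk g n \<omega> \<ge> real n * (b - 2 * e)" by linarith
  \<comment> \<open>The first \<open>k + n\<close> digits determine \<open>birk g n\<close>; one
    more digit is left free.\<close>
  define p where "p = k + n + 1"
  define X where "X = free_digit_set (coord \<omega>) p"
  have "p > 0" by (simp add: p_def)
  \<comment> \<open>Lowering \<open>b - 2 * e\<close> by another \<open>e\<close> pays for the last
    \<open>Suc k\<close> terms, which may see the free digit and the next block.\<close>
  have block: "birk g p y \<ge> real p * (b - 3 * e)" if "y \<in> X" for y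
  proof -
    have "coord y i = coord \<omega> i" if "i < k + n" for i
      using \<open>y \<in> X\<close> that by (auto simp: X_def free_digit_set_def p_def dest!: spec[of _ i])
    then have "birk g n y = birk g n \<omega>"
      by (rule dependsD[OF depends_birk[OF g]])
    moreover have "birk g p y = birk g n y + birk g (Suc k) ((shift ^^ n) y)"
      using birk_add[of g n "Suc k" y] by (simp add: p_def algebra_simps)
    moreover have "birk g (Suc k) ((shift ^^ n) y) \<ge> - (real (Suc k) * B)"
      using birk_B[of "Suc k" "(shift ^^ n) y"] by linarith
    moreover have "real (Suc k) * (b - 3 * e) \<le> real (Suc k) * \<bar>b - 3 * e\<bar>"
      by (intro mult_left_mono) auto
    ultimately have "birk g p y \<ge> real n * (b - 3 * e) + real (Suc k) * (b - 3 * e)"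
      using \<omega> n(2) unfolding distrib_left right_diff_distrib by linarith
    then show ?thesis by (simp add: p_def algebra_simps)
  qed
  \<comment> \<open>The fourth \<open>e\<close> yields a gain linear in \<open>q\<close>, which
    outweighs \<open>K\<close> and the alignment cost \<open>2 * p * B\<close>.\<close>
  have hX: "\<exists>L>0. \<forall>x\<in>X. \<forall>j. birk g L ((shift ^^ j) x) \<ge> real L * (b - 4 * e) + K" for K
  proof -
    obtain q' where q': "real q' * e > \<bar>K\<bar> + 2 * real p * B"
      using reals_Archimedean3[OF \<open>e > 0\<close>] by blast
    define q where "q = Suc q'"
    have "real q' * e \<le> real (p * q) * e"
      using \<open>e > 0\<close> by (intro mult_right_mono) (auto simp: q_def p_def)
    moreover have "real (p * q) * (b - 4 * e) = real (p * q) * (b - 3 * e) - real (p * q) * e"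
      by (simp only: right_diff_distrib)
    ultimately have "real (p * q) * (b - 4 * e) + K \<le> real (p * q) * (b - 3 * e) - 2 * real p * B"
      using q' by linarith
    then have "\<forall>x\<in>X. \<forall>j. birk g (p * q) ((shift ^^ j) x) \<ge> real (p * q) * (b - 4 * e) + K"
      using birk_free_digit_set[of g B p "coord \<omega>" "b - 3 * e", OF B(2) \<open>p > 0\<close> block[unfolded X_def]]
      unfolding X_def by (meson order_trans)
    moreover have "p * q > 0" by (simp add: p_def q_def)
    ultimately show ?thesis by blast
  qed
  have surj: "{0..<1} \<subseteq> free_value p ` X"
    unfolding X_def using free_value_surj[OF \<open>p > 0\<close>] by auto
  then have "X \<noteq> {}" by auto
  have "4 * e > 0" using \<open>e > 0\<close> by simp
  obtain h :: cfun where h: "h \<in> PCC" "\<And>\<omega>. \<bar>h \<omega> - g \<omega>\<bar> \<le> 4 * e"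
    "alpha_max h = b" "X \<subseteq> birkhoff_level h b"
    using flattening_perturbation[OF g n0 \<open>4 * e > 0\<close> hX \<open>X \<noteq> {}\<close>] by blast
  have "ennreal (1 / real p) \<le> birkhoff_spectrum h (alpha_max h)"
    unfolding birkhoff_spectrum_def h(3)
    using surj _ _ _ h(4)
    by (rule hausdorff_dim_ge_hoelder[where C = 2])
       (use free_value_hoelder[OF \<open>p > 0\<close>] \<open>p > 0\<close> in \<open>auto simp: X_def\<close>)
  moreover have "ennreal (1 / real p) > 0" using \<open>p > 0\<close> by simp
  ultimately have "birkhoff_spectrum h (alpha_max h) > 0" by (rule order_less_le_trans[rotated])
  with h that show ?thesis by blast
qed

theorem theorem4p1p1:
  shows "closure {h \<in> PCC. birkhoff_spectrum h (alpha_max h) > 0} = (UNIV :: cfun set)"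
proof -
  have "\<exists>h\<in>{h \<in> PCC. birkhoff_spectrum h (alpha_max h) > 0}. dist h f < r" if "r > 0" for f :: cfun and r
  proof -
    \<comment> \<open>Approximating \<open>f\<close> costs \<open>e\<close> and the perturbation
      \<open>4 * e\<close>, which together stay below \<open>r\<close>.\<close>
    define e where "e = r / 6"
    have "e > 0" using that by (simp add: e_def)
    obtain k g where g: "depends k g" "\<And>\<omega>. \<bar>f \<omega> - g \<omega>\<bar> \<le> e"
      using depends_dense[OF \<open>e > 0\<close>, of f] by blast
    obtain h :: cfun where h: "h \<in> PCC" "\<And>\<omega>. \<bar>h \<omega> - g \<omega>\<bar> \<le> 4 * e"
      "birkhoff_spectrum h (alpha_max h) > 0"
      using exists_perturbation[OF g(1) \<open>e > 0\<close>] by blast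
    have "dist h f \<le> 5 * e"
    proof (rule dist_bound)
      fix \<omega> show "dist (h \<omega>) (f \<omega>) \<le> 5 * e"
        using g(2)[of \<omega>] h(2)[of \<omega>] unfolding dist_real_def by linarith
    qed
    also have "\<dots> < r" using that by (simp add: e_def)
    finally show ?thesis using h by blast
  qed
  then show ?thesis by (auto simp: closure_approachable)
qed

end
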